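(* Let $\mathcal{C}=(\mathrm{A},\Gamma)$ be a contract (with input space $\mathcal{U}$ and output space $\mathcal{Y}$) and let $\Sigma$ be a system with input space $\mathcal{U}$ and output space $\mathcal{Y}$. Then $\Sigma$ implements $\mathcal{C}$ if and only if $$\mathrm{A}\wedge\Sigma\preccurlyeq\Gamma .$$
   Context: All spaces are finite-dimensional real linear spaces and all maps are linear. **Systems.** A system $\Sigma$ with input space $\mathcal{U}$ and output space $\mathcal{Y}$ is given by $\dot x = Ax+Bu+Gd,\ y=Cx$, with state $x\in\mathcal{X}$, input $u\in\mathcal{U}$, output $y\in\mathcal{Y}$, driving variable $d\in\mathcal{D}$. **Systems with constraints.** A system $\Xi_i$ is given by $\dot x_i=A_ix_i+G_id_i,\ w_i=C_ix_i,\ 0=H_ix_i$, with state $x_i\in\mathcal{X}_i$, output $w_i\in\mathcal{W}_i$, driving variable $d_i\in\mathcal{D}_i$. Its *consistent subspace* $\mathcal{V}_i\subset\mathcal{X}_i$ is the set of initial states $x_i(0)$ for which there is $d_i:\mathbb{R}_{\ge0}\to\mathcal{D}_i$ such that the resulting trajectory satisfies $H_ix_i(t)=0$ for all $t\ge0$. Equivalently, $\mathcal{V}_i$ is the largest subspace with $A_i\mathcal{V}_i\subset\mathcal{V}_i+\operatorname{im}G_i$ and $\mathcal{V}_i\subset\ker H_i$. **Simulation.** Let $\Xi_1,\Xi_2$ have the same output space, and let $\pi_{\mathcal{X}_i}$ denote projection of subspaces of $\mathcal{X}_1\times\mathcal{X}_2$ onto $\mathcal{X}_i$. A subspace $\mathcal{S}\subset\mathcal{X}_1\times\mathcal{X}_2$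 with $\pi_{\mathcal{X}_i}(\mathcal{S})\subset\mathcal{V}_i$, $i=1,2$, is a *simulation relation* of $\Xi_1$ by $\Xi_2$ if for all $(x_1(0),x_2(0))\in\mathcal{S}$ and all $d_1:\mathbb{R}_{\ge0}\to\mathcal{D}_1$ such that $x_1(t)\in\mathcal{V}_1$ for all $t\ge0$, there exists $d_2:\mathbb{R}_{\ge0}\to\mathcal{D}_2$ such that $(x_1(t),x_2(t))\in\mathcal{S}$ and $w_1(t)=w_2(t)$ for all $t\ge0$. A known equivalent algebraic characterization is: for all $(x_1,x_2)\in\mathcal{S}$ and all $d_1\in\mathcal{D}_1$ with $A_1x_1+G_1d_1\in\mathcal{V}_1$, there exists $d_2\in\mathcal{D}_2$ such that $(A_1x_1+G_1d_1,\,A_2x_2+G_2d_2)\in\mathcal{S}$ and $C_1x_1=C_2x_2$. $\Xi_1$ is *simulated by* $\Xi_2$, written $\Xi_1\preccurlyeq\Xi_2$, if there is a simulation relation $\mathcal{S}$ of $\Xi_1$ by $\Xi_2$ with $\pi_{\mathcal{X}_1}(\mathcal{S})=\mathcal{V}_1$. **Environments, assumptions, guarantees, contracts.** An *environment* $\mathrm{E}$ is a constrained system with output $u\in\mathcal{U}$: $\dot x_e=A_ex_e+G_ed_e,\ u=C_ex_e,\ 0=H_ex_e$. *Assumptions* $\mathrm{A}$ are a system of the same form: $\dot x_a=A_ax_a+G_ad_a,\ u=C_ax_a,\ 0=H_ax_a$. *Guarantees* $\Gamma$ are a constrained system with output $(u,y)\in\mathcal{U}\times\mathcal{Y}$: $\dot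 x_g=A_gx_g+G_gd_g,\ u=C_g^ux_g,\ y=C_g^yx_g,\ 0=H_gx_g$. A *contract* $\mathcal{C}=(\mathrm{A},\Gamma)$ is a pair of assumptions and guarantees. **Interconnection with a system.** For an environment (or assumptions) $\mathrm{E}$ and a system $\Sigma$, $\mathrm{E}\wedge\Sigma$ is the constrained system with state $(x_e,x)\in\mathcal{X}_e\times\mathcal{X}$, driving variable $(d_e,d)$ and output $(u,y)$ given by $\dot x_e=A_ex_e+G_ed_e,\ \dot x=BC_ex_e+Ax+Gd,\ u=C_ex_e,\ y=Cx,\ 0=H_ex_e$. **Implementation.** An environment $\mathrm{E}$ is *compatible* with $\mathcal{C}=(\mathrm{A},\Gamma)$ if $\mathrm{E}\preccurlyeq\mathrm{A}$. A system $\Sigma$ *implements* $\mathcal{C}$ if $\mathrm{E}\wedge\Sigma\preccurlyeq\Gamma$ for every environment $\mathrm{E}$ compatible with $\mathcal{C}$. *)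

theory Defs
  imports Complex_Main "Jordan_Normal_Form.Matrix"
begin

text \<open>
  A finite-dimensional real linear space is taken in coordinates, as \<open>carrier_vec n\<close> over the reals
  for some \<open>n\<close> (\<open>n = 0\<close> included), and a linear map as a matrix. Dimensions are ordinary natural
  numbers, so that one can quantify over all environments, whatever the dimensions of
  their state and driving variable spaces. A product of two such spaces, when it serves as the state,
  driving variable or output space of a system, is identified with \<open>carrier_vec (n1 + n2)\<close> through
  concatenation \<open>@\<^sub>v\<close>.
\<close>

text \<open>Systems \<open>x' = A x + B u + G d, y = C x\<close>.\<close>

record lin_sys =
  sys_A :: "real mat"
  sys_B :: "real mat"
  sys_G :: "real mat"
  sys_C :: "real mat"

definition is_system :: "nat \<Rightarrow> nat \<Rightarrow> lin_sys \<Rightarrow> bool" where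
  "is_system m p \<Sigma> \<longleftrightarrow>
     (\<exists>n k. sys_A \<Sigma> \<in> carrier_mat n n \<and> sys_B \<Sigma> \<in> carrier_mat n m \<and>
            sys_G \<Sigma> \<in> carrier_mat n k \<and> sys_C \<Sigma> \<in> carrier_mat p n)"

text \<open>Systems with constraints \<open>x' = A x + G d, w = C x, 0 = H x\<close>.\<close>

record con_sys =
  con_A :: "real mat"
  con_G :: "real mat"
  con_C :: "real mat"
  con_H :: "real mat"

definition is_con_sys :: "nat \<Rightarrow> con_sys \<Rightarrow> bool" where
  "is_con_sys q \<Xi> \<longleftrightarrow>
     (\<exists>n k h. con_A \<Xi> \<in> carrier_mat n n \<and> con_G \<Xi> \<in> carrier_mat n k \<and>
              con_C \<Xi> \<in> carrier_mat q n \<and> con_H \<Xi> \<in> carrier_mat h n)"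

definition state_dim :: "con_sys \<Rightarrow> nat" where
  "state_dim \<Xi> = dim_row (con_A \<Xi>)"

definition driving_dim :: "con_sys \<Rightarrow> nat" where
  "driving_dim \<Xi> = dim_col (con_G \<Xi>)"

text \<open>
  The state trajectory \<open>x\<close> is a classical solution for the driving variable \<open>d\<close>: the differential
  equation holds at every \<open>t \<ge> 0\<close>, with the one-sided derivative at \<open>0\<close>. No regularity of \<open>d\<close> is
  imposed beyond the existence of such an \<open>x\<close>. Values at negative times are irrelevant. The
  constraint \<open>0 = H x\<close> is deliberately not part of this definition. Since \<open>x\<close> is determined by
  \<open>x 0\<close> and \<open>d\<close>, quantifying over a driving variable and its resulting trajectory is
  quantifying over pairs \<open>x, d\<close> with a prescribed \<open>x 0\<close>.
\<close>

definition trajectory :: "con_sys \<Rightarrow> (real \<Rightarrow> real vec) \<Rightarrow> (real \<Rightarrow> real vec) \<Rightarrow> bool" where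
  "trajectory \<Xi> x d \<longleftrightarrow>
     (\<forall>t\<ge>0. x t \<in> carrier_vec (state_dim \<Xi>) \<and> d t \<in> carrier_vec (driving_dim \<Xi>) \<and>
       (\<forall>i<state_dim \<Xi>.
          ((\<lambda>s. x s $ i) has_real_derivative
             (con_A \<Xi> *\<^sub>v x t + con_G \<Xi> *\<^sub>v d t) $ i) (at t within {0..})))"

definition consistent :: "con_sys \<Rightarrow> real vec set" where
  "consistent \<Xi> =
     {x0 \<in> carrier_vec (state_dim \<Xi>).
        \<exists>x d. trajectory \<Xi> x d \<and> x 0 = x0 \<and>
              (\<forall>t\<ge>0. con_H \<Xi> *\<^sub>v x t = 0\<^sub>v (dim_row (con_H \<Xi>)))}"

definition subspace_prod :: "nat \<Rightarrow> nat \<Rightarrow> (real vec \<times> real vec) set \<Rightarrow> bool" where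
  "subspace_prod n1 n2 S \<longleftrightarrow>
     S \<subseteq> carrier_vec n1 \<times> carrier_vec n2 \<and>
     (0\<^sub>v n1, 0\<^sub>v n2) \<in> S \<and>
     (\<forall>(x1, x2) \<in> S. \<forall>(y1, y2) \<in> S. (x1 + y1, x2 + y2) \<in> S) \<and>
     (\<forall>a. \<forall>(x1, x2) \<in> S. (a \<cdot>\<^sub>v x1, a \<cdot>\<^sub>v x2) \<in> S)"

definition simulation_relation ::
  "con_sys \<Rightarrow> con_sys \<Rightarrow> (real vec \<times> real vec) set \<Rightarrow> bool" where
  "simulation_relation \<Xi>1 \<Xi>2 S \<longleftrightarrow>
     subspace_prod (state_dim \<Xi>1) (state_dim \<Xi>2) S \<and>
     fst ` S \<subseteq> consistent \<Xi>1 \<and> snd ` S \<subseteq> consistent \<Xi>2 \<and>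
     (\<forall>x1 d1 z2. (x1 0, z2) \<in> S \<and> trajectory \<Xi>1 x1 d1 \<and> (\<forall>t\<ge>0. x1 t \<in> consistent \<Xi>1) \<longrightarrow>
        (\<exists>x2 d2. trajectory \<Xi>2 x2 d2 \<and> x2 0 = z2 \<and>
           (\<forall>t\<ge>0. (x1 t, x2 t) \<in> S \<and> con_C \<Xi>1 *\<^sub>v x1 t = con_C \<Xi>2 *\<^sub>v x2 t)))"

definition simulated_by :: "con_sys \<Rightarrow> con_sys \<Rightarrow> bool"  (infix \<open>\<preceq>\<close> 50) where
  "\<Xi>1 \<preceq> \<Xi>2 \<longleftrightarrow> (\<exists>S. simulation_relation \<Xi>1 \<Xi>2 S \<and> fst ` S = consistent \<Xi>1)"

text \<open>
  For guarantees, the first \<open>m\<close> rows of the output matrix give the output \<open>u\<close>, the remaining \<open>p\<close>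
  rows the output \<open>y\<close>.
\<close>

definition is_environment :: "nat \<Rightarrow> con_sys \<Rightarrow> bool" where
  "is_environment m E \<longleftrightarrow> is_con_sys m E"

definition is_guarantees :: "nat \<Rightarrow> nat \<Rightarrow> con_sys \<Rightarrow> bool" where
  "is_guarantees m p \<Gamma> \<longleftrightarrow> is_con_sys (m + p) \<Gamma>"

record contract =
  assumptions :: con_sys
  guarantees :: con_sys

definition is_contract :: "nat \<Rightarrow> nat \<Rightarrow> contract \<Rightarrow> bool" where
  "is_contract m p \<C> \<longleftrightarrow>
     is_environment m (assumptions \<C>) \<and> is_guarantees m p (guarantees \<C>)"

text \<open>
  State \<open>xe @\<^sub>v x\<close>, driving variable \<open>de @\<^sub>v d\<close>, output \<open>u @\<^sub>v y\<close>. The lower blocks of the constraint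
  matrix have no rows: only \<open>0 = He xe\<close> is imposed.
\<close>

definition interconnection :: "con_sys \<Rightarrow> lin_sys \<Rightarrow> con_sys"  (infix \<open>\<and>\<^sub>s\<close> 60) where
  "E \<and>\<^sub>s \<Sigma> =
     (let ne = dim_row (con_A E); ke = dim_col (con_G E);
          n = dim_row (sys_A \<Sigma>); k = dim_col (sys_G \<Sigma>);
          m = dim_row (con_C E); p = dim_row (sys_C \<Sigma>); h = dim_row (con_H E)
      in \<lparr> con_A = four_block_mat (con_A E)              (0\<^sub>m ne n)
                                  (sys_B \<Sigma> * con_C E)    (sys_A \<Sigma>),
           con_G = four_block_mat (con_G E)   (0\<^sub>m ne k)
                                  (0\<^sub>m n ke)   (sys_G \<Sigma>),
           con_C = four_block_mat (con_C E)   (0\<^sub>m m n)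
                                  (0\<^sub>m p ne)   (sys_C \<Sigma>),
           con_H = four_block_mat (con_H E)   (0\<^sub>m h n)
                                  (0\<^sub>m 0 ne)   (0\<^sub>m 0 n) \<rparr>)"

definition compatible :: "nat \<Rightarrow> con_sys \<Rightarrow> contract \<Rightarrow> bool" where
  "compatible m E \<C> \<longleftrightarrow> is_environment m E \<and> E \<preceq> assumptions \<C>"

definition implements :: "nat \<Rightarrow> lin_sys \<Rightarrow> contract \<Rightarrow> bool" where
  "implements m \<Sigma> \<C> \<longleftrightarrow> (\<forall>E. compatible m E \<C> \<longrightarrow> E \<and>\<^sub>s \<Sigma> \<preceq> guarantees \<C>)"

end

theory Submission
  imports "HOL-Analysis.Henstock_Kurzweil_Integration" Defs
begin

text \<open>
  Since every assumption simulates itself, \<open>A\<close> is compatible with the contract, which gives one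
  direction. For the other, simulation is transitive and \<open>E \<preceq> A\<close> implies
  \<open>E \<and>\<^sub>s \<Sigma> \<preceq> A \<and>\<^sub>s \<Sigma>\<close>: if \<open>S\<close> simulates \<open>E\<close> by \<open>A\<close>, then the pairs
  \<open>(xe @\<^sub>v x, xa @\<^sub>v x)\<close> with \<open>(xe, xa) \<in> S\<close> and \<open>x\<close> arbitrary form a simulation relation, because
  related trajectories produce the same input of \<open>\<Sigma>\<close>. That this relation projects onto the consistent
  subspace of \<open>E \<and>\<^sub>s \<Sigma>\<close> requires that \<open>\<Sigma>\<close> has a trajectory for every initial state and every
  continuous input, which is variation of constants with the matrix exponential.
\<close>

unbundle no vec_syntax

section \<open>The matrix exponential and forced linear differential equations\<close>

text \<open>
  A series of entries, as the type of matrices of all dimensions carries no norm.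
\<close>

definition mat_exp :: "real mat \<Rightarrow> real \<Rightarrow> real mat" where
  "mat_exp A t = mat (dim_row A) (dim_row A) (\<lambda>(i, j). \<Sum>k. (A ^\<^sub>m k) $$ (i, j) / fact k * t ^ k)"

lemma mat_exp_carrier [simp]: "A \<in> carrier_mat n n \<Longrightarrow> mat_exp A t \<in> carrier_mat n n"
  by (auto simp: mat_exp_def)

lemma mat_exp_index:
  assumes "A \<in> carrier_mat n n" "i < n" "j < n"
  shows "mat_exp A t $$ (i, j) = (\<Sum>k. (A ^\<^sub>m k) $$ (i, j) / fact k * t ^ k)"
  using assms by (auto simp: mat_exp_def)

section \<open>Entrywise products and convergence of the exponential series\<close>

lemma index_mult_mat_sum:
  assumes "A \<in> carrier_mat n k" "B \<in> carrier_mat k m" "i < n" "j < m"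
  shows "(A * B) $$ (i, j) = (\<Sum>l\<in>{0..<k}. A $$ (i, l) * B $$ (l, j))"
  using assms by (auto simp: scalar_prod_def intro!: sum.cong)

lemma index_mult_mat_vec_sum:
  assumes "A \<in> carrier_mat n k" "v \<in> carrier_vec k" "i < n"
  shows "(A *\<^sub>v v) $ i = (\<Sum>l\<in>{0..<k}. A $$ (i, l) * v $ l)"
  using assms by (auto simp: scalar_prod_def intro!: sum.cong)

text \<open>An entrywise bound stands in for a submultiplicative norm: one more factor
  \<open>A\<close> turns an entry into a sum of \<open>n\<close> products, so the bound grows by a
  fixed factor with each power.\<close>

lemma pow_mat_entry_bound:
  fixes A :: "real mat"
  assumes A: "A \<in> carrier_mat n n"
  obtains c where "c \<ge> 0" "\<And>k i j. i < n \<Longrightarrow> j < n \<Longrightarrow> \<bar>(A ^\<^sub>m k) $$ (i, j)\<bar> \<le> c ^ k"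
proof -
  \<comment> \<open>The sum of all absolute entries dominates each of them and also makes sense for
    \<open>n = 0\<close>, where a maximum would range over no entries.\<close>
  define b where "b = (\<Sum>i\<in>{0..<n}. \<Sum>j\<in>{0..<n}. \<bar>A $$ (i, j)\<bar>)"
  have b: "\<bar>A $$ (i, j)\<bar> \<le> b" if "i < n" "j < n" for i j
  proof -
    have "\<bar>A $$ (i, j)\<bar> \<le> (\<Sum>j\<in>{0..<n}. \<bar>A $$ (i, j)\<bar>)"
      using that by (intro member_le_sum) auto
    also have "\<dots> \<le> b"
      unfolding b_def using that
      by (intro member_le_sum[of i _ "\<lambda>i. \<Sum>j\<in>{0..<n}. \<bar>A $$ (i, j)\<bar>"]) (auto intro: sum_nonneg)
    finally show ?thesis .
  qed
  have b0: "b \<ge> 0" unfolding b_def by (intro sum_nonneg) auto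
  \<comment> \<open>Each of the \<open>n\<close> summands of an entry of
    \<open>A ^\<^sub>m k * A\<close> is at most \<open>c ^ k * b\<close> in absolute value.\<close>
  define c where "c = real n * b"
  have c0: "c \<ge> 0" using b0 by (simp add: c_def)
  have "\<bar>(A ^\<^sub>m k) $$ (i, j)\<bar> \<le> c ^ k" if "i < n" "j < n" for k i j
    using that
  proof (induction k arbitrary: i j)
    case 0
    then show ?case using A by auto
  next
    case (Suc k)
    have "(A ^\<^sub>m Suc k) $$ (i, j) = (\<Sum>l\<in>{0..<n}. (A ^\<^sub>m k) $$ (i, l) * A $$ (l, j))"
      using index_mult_mat_sum[OF pow_carrier_mat[OF A, of k] A Suc.prems] by simp
    also have "\<bar>\<dots>\<bar> \<le> (\<Sum>l\<in>{0..<n}. \<bar>(A ^\<^sub>m k) $$ (i, l) * A $$ (l, j)\<bar>)"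
      by (rule sum_abs)
    also have "\<dots> \<le> (\<Sum>l\<in>{0..<n}. c ^ k * b)"
      using Suc b c0 b0 by (intro sum_mono) (auto simp: abs_mult intro!: mult_mono)
    also have "\<dots> = c ^ Suc k" by (simp add: c_def)
    finally show ?case .
  qed
  with c0 show thesis by (rule that)
qed

text \<open>The entry bound makes the scalar exponential series at \<open>c * \<bar>t\<bar>\<close>
  a majorant, for every \<open>t\<close>.\<close>

lemma summable_mat_exp:
  fixes A :: "real mat"
  assumes A: "A \<in> carrier_mat n n" and ij: "i < n" "j < n"
  shows "summable (\<lambda>k. (A ^\<^sub>m k) $$ (i, j) / fact k * t ^ k)"
proof -
  obtain c where "c \<ge> 0"
    and c: "\<And>k i j. i < n \<Longrightarrow> j < n \<Longrightarrow> \<bar>(A ^\<^sub>m k) $$ (i, j)\<bar> \<le> c ^ k"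
    using pow_mat_entry_bound[OF A] by blast
  have "summable (\<lambda>k. (c * \<bar>t\<bar>) ^ k /\<^sub>R fact k)" by (rule summable_exp_generic)
  then show ?thesis
  proof (rule summable_comparison_test'[where N = 0])
    fix k :: nat
    have "\<bar>(A ^\<^sub>m k) $$ (i, j)\<bar> * \<bar>t\<bar> ^ k \<le> c ^ k * \<bar>t\<bar> ^ k"
      using c[OF ij] by (intro mult_right_mono) auto
    then show "norm ((A ^\<^sub>m k) $$ (i, j) / fact k * t ^ k) \<le> (c * \<bar>t\<bar>) ^ k /\<^sub>R fact k"
      by (simp add: abs_mult power_abs power_mult_distrib divide_simps)
  qed
qed

text \<open>\<open>pow_mat\<close> appends its factors on the right; with this version
  \<open>A\<close> can be split off on either side when the exponential series is
  differentiated.\<close>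

lemma pow_mat_Suc_left:
  fixes A :: "'a :: semiring_1 mat"
  assumes A: "A \<in> carrier_mat n n"
  shows "A ^\<^sub>m Suc k = A * A ^\<^sub>m k"
proof (induction k)
  case 0
  then show ?case using A by simp
next
  case (Suc k)
  have "A ^\<^sub>m Suc (Suc k) = (A * A ^\<^sub>m k) * A" using Suc by simp
  also have "\<dots> = A * A ^\<^sub>m Suc k"
    using assoc_mult_mat[OF A pow_carrier_mat[OF A] A] by simp
  finally show ?case .
qed

text \<open>Differentiating term by term, the factor \<open>k + 1\<close> cancels against
  \<open>fact (Suc k)\<close> and leaves the next power of \<open>A\<close>. That power is kept
  whole, so that it can be split on either side.\<close>

lemma mat_exp_has_derivative_series:
  assumes A: "A \<in> carrier_mat n n" and ij: "i < n" "j < n"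
  shows "((\<lambda>t. mat_exp A t $$ (i, j)) has_real_derivative
    (\<Sum>k. (A ^\<^sub>m Suc k) $$ (i, j) / fact k * t ^ k)) (at t)"
proof -
  let ?c = "\<lambda>k. (A ^\<^sub>m k) $$ (i, j) / fact k"
  have "((\<lambda>t. \<Sum>k. ?c k * t ^ k) has_real_derivative (\<Sum>k. diffs ?c k * t ^ k)) (at t)"
    by (rule termdiffs_strong_converges_everywhere) (rule summable_mat_exp[OF A ij])
  moreover have "diffs ?c k = (A ^\<^sub>m Suc k) $$ (i, j) / fact k" for k
    by (simp add: diffs_def divide_simps del: pow_mat.simps of_nat_Suc)
  ultimately show ?thesis
    by (simp add: mat_exp_index[OF A ij] del: pow_mat.simps)
qed

text \<open>Splitting off \<open>A\<close> on the left writes each coefficient as a finite sum over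
  \<open>l\<close>, which may be exchanged with the convergent series.\<close>

lemma mat_exp_has_derivative_left:
  assumes A: "A \<in> carrier_mat n n" and ij: "i < n" "j < n"
  shows "((\<lambda>t. mat_exp A t $$ (i, j)) has_real_derivative (A * mat_exp A t) $$ (i, j)) (at t)"
proof -
  have "(\<Sum>k. (A ^\<^sub>m Suc k) $$ (i, j) / fact k * t ^ k) =
      (\<Sum>k. \<Sum>l\<in>{0..<n}. A $$ (i, l) * ((A ^\<^sub>m k) $$ (l, j) / fact k * t ^ k))"
    unfolding pow_mat_Suc_left[OF A] index_mult_mat_sum[OF A pow_carrier_mat[OF A] ij]
    by (simp add: sum_divide_distrib sum_distrib_right mult.assoc)
  also have "\<dots> = (\<Sum>l\<in>{0..<n}. \<Sum>k. A $$ (i, l) * ((A ^\<^sub>m k) $$ (l, j) / fact k * t ^ k))"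
    using ij by (intro suminf_sum summable_mult summable_mat_exp[OF A]) auto
  also have "\<dots> = (\<Sum>l\<in>{0..<n}. A $$ (i, l) * mat_exp A t $$ (l, j))"
    using ij by (intro sum.cong refl) (simp only: mat_exp_index[OF A] suminf_mult summable_mat_exp[OF A] atLeastLessThan_iff)
  also have "\<dots> = (A * mat_exp A t) $$ (i, j)"
    using A ij by (simp add: index_mult_mat_sum[OF A mat_exp_carrier[OF A]])
  finally show ?thesis using mat_exp_has_derivative_series[OF assms] by metis
qed

text \<open>Having the form with \<open>A\<close> on the right as well spares a commutation argument
  when \<open>mat_exp A (- t)\<close> is multiplied by \<open>mat_exp A t\<close>.\<close>

lemma mat_exp_has_derivative_right:
  assumes A: "A \<in> carrier_mat n n" and ij: "i < n" "j < n"
  shows "((\<lambda>t. mat_exp A t $$ (i, j)) has_real_derivative (mat_exp A t * A) $$ (i, j)) (at t)"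
proof -
  have "(\<Sum>k. (A ^\<^sub>m Suc k) $$ (i, j) / fact k * t ^ k) =
      (\<Sum>k. \<Sum>l\<in>{0..<n}. ((A ^\<^sub>m k) $$ (i, l) / fact k * t ^ k) * A $$ (l, j))"
    unfolding pow_mat.simps index_mult_mat_sum[OF pow_carrier_mat[OF A] A ij]
    by (simp add: sum_divide_distrib sum_distrib_left mult_ac)
  also have "\<dots> = (\<Sum>l\<in>{0..<n}. \<Sum>k. ((A ^\<^sub>m k) $$ (i, l) / fact k * t ^ k) * A $$ (l, j))"
    using ij by (intro suminf_sum summable_mult2 summable_mat_exp[OF A]) auto
  also have "\<dots> = (\<Sum>l\<in>{0..<n}. mat_exp A t $$ (i, l) * A $$ (l, j))"
    using ij by (intro sum.cong refl)
      (simp only: mat_exp_index[OF A] suminf_mult2 summable_mat_exp[OF A] atLeastLessThan_iff)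
  also have "\<dots> = (mat_exp A t * A) $$ (i, j)"
    using A ij by (simp add: index_mult_mat_sum[OF mat_exp_carrier[OF A] A])
  finally show ?thesis using mat_exp_has_derivative_series[OF assms] by metis
qed

lemma mat_exp_0:
  assumes A: "A \<in> carrier_mat n n"
  shows "mat_exp A 0 = 1\<^sub>m n"
proof (rule eq_matI)
  fix i j assume ij: "i < dim_row (1\<^sub>m n)" "j < dim_col (1\<^sub>m n)"
  then have "mat_exp A 0 $$ (i, j) = (\<Sum>k. (A ^\<^sub>m k) $$ (i, j) / fact k * 0 ^ k)"
    using mat_exp_index[OF A] by simp
  also have "\<dots> = (A ^\<^sub>m 0) $$ (i, j)" by (subst powser_zero) simp
  finally show "mat_exp A 0 $$ (i, j) = 1\<^sub>m n $$ (i, j)" using A by simp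
qed (use mat_exp_carrier[OF A, of 0] in auto)

section \<open>Product rules and the inverse of the exponential\<close>

lemma mult_mat_has_derivative:
  assumes M: "\<And>t. M t \<in> carrier_mat n k" and N: "\<And>t. N t \<in> carrier_mat k m"
    and M': "M' \<in> carrier_mat n k" and N': "N' \<in> carrier_mat k m"
    and dM: "\<And>i j. i < n \<Longrightarrow> j < k \<Longrightarrow> ((\<lambda>s. M s $$ (i, j)) has_real_derivative M' $$ (i, j)) (at t within T)"
    and dN: "\<And>i j. i < k \<Longrightarrow> j < m \<Longrightarrow> ((\<lambda>s. N s $$ (i, j)) has_real_derivative N' $$ (i, j)) (at t within T)"
    and ij: "i < n" "j < m"
  shows "((\<lambda>s. (M s * N s) $$ (i, j)) has_real_derivative (M' * N t + M t * N') $$ (i, j)) (at t within T)"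
proof -
  have "((\<lambda>s. \<Sum>l\<in>{0..<k}. M s $$ (i, l) * N s $$ (l, j)) has_real_derivative
     (\<Sum>l\<in>{0..<k}. M' $$ (i, l) * N t $$ (l, j) + N' $$ (l, j) * M t $$ (i, l))) (at t within T)"
    using ij by (intro DERIV_sum DERIV_mult dM dN) auto
  moreover have "(M' * N t + M t * N') $$ (i, j) = (M' * N t) $$ (i, j) + (M t * N') $$ (i, j)"
    using ij carrier_matD[OF M] N' by (intro index_add_mat) auto
  ultimately show ?thesis
    by (simp only: index_mult_mat_sum[OF M N ij] index_mult_mat_sum[OF M' N ij]
        index_mult_mat_sum[OF M N' ij] sum.distrib mult.commute[of "N' $$ _"])
qed

lemma mult_mat_vec_has_derivative:
  assumes M: "\<And>t. M t \<in> carrier_mat n k" and v: "\<And>t. v t \<in> carrier_vec k"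
    and M': "M' \<in> carrier_mat n k" and v': "v' \<in> carrier_vec k"
    and dM: "\<And>i j. i < n \<Longrightarrow> j < k \<Longrightarrow> ((\<lambda>s. M s $$ (i, j)) has_real_derivative M' $$ (i, j)) (at t within T)"
    and dv: "\<And>i. i < k \<Longrightarrow> ((\<lambda>s. v s $ i) has_real_derivative v' $ i) (at t within T)"
    and i: "i < n"
  shows "((\<lambda>s. (M s *\<^sub>v v s) $ i) has_real_derivative (M' *\<^sub>v v t + M t *\<^sub>v v') $ i) (at t within T)"
proof -
  have "((\<lambda>s. \<Sum>l\<in>{0..<k}. M s $$ (i, l) * v s $ l) has_real_derivative
     (\<Sum>l\<in>{0..<k}. M' $$ (i, l) * v t $ l + v' $ l * M t $$ (i, l))) (at t within T)"
    using i by (intro DERIV_sum DERIV_mult dM dv) auto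
  moreover have "(M' *\<^sub>v v t + M t *\<^sub>v v') $ i = (M' *\<^sub>v v t) $ i + (M t *\<^sub>v v') $ i"
    using i carrier_matD[OF M] by (intro index_add_vec) auto
  ultimately show ?thesis
    by (simp only: index_mult_mat_vec_sum[OF M v i] index_mult_mat_vec_sum[OF M' v i]
        index_mult_mat_vec_sum[OF M v' i] sum.distrib mult.commute[of "v' $ _"])
qed

text \<open>The product is constant in \<open>t\<close>: its derivative consists of two terms with
  \<open>A\<close> between the exponentials and opposite signs. At \<open>t = 0\<close> it is the
  identity.\<close>

lemma mat_exp_minus_mult:
  assumes A: "A \<in> carrier_mat n n"
  shows "mat_exp A (- t) * mat_exp A t = 1\<^sub>m n"
proof (rule eq_matI)
  fix i j assume "i < dim_row (1\<^sub>m n :: real mat)" "j < dim_col (1\<^sub>m n :: real mat)"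
  then have ij: "i < n" "j < n" by auto
  let ?E = "mat_exp A"
  have E: "?E t \<in> carrier_mat n n" for t using A by simp
  have "((\<lambda>s. (?E (- s) * ?E s) $$ (i, j)) has_real_derivative 0) (at t)" for t
  proof -
    \<comment> \<open>The right form of the derivative leaves \<open>A\<close> next to the second
      factor, where it meets the \<open>A\<close> from the left form.\<close>
    have d: "((\<lambda>s. ?E (- s) $$ (i, j)) has_real_derivative (- (?E (- t) * A)) $$ (i, j)) (at t)"
      if "i < n" "j < n" for i j
      using DERIV_chain2[OF mat_exp_has_derivative_right[OF A that] DERIV_minus[OF DERIV_ident, of t UNIV]]
        that A carrier_matD[OF E[of "- t"]] by simp
    have "((\<lambda>s. (?E (- s) * ?E s) $$ (i, j)) has_real_derivative
        (- (?E (- t) * A) * ?E t + ?E (- t) * (A * ?E t)) $$ (i, j)) (at t)"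
      by (rule mult_mat_has_derivative[OF E E _ _ d mat_exp_has_derivative_left[OF A] ij])
        (use mult_carrier_mat[OF E A] mult_carrier_mat[OF A E] in auto)
    moreover have "- (?E (- t) * A) * ?E t = - (?E (- t) * (A * ?E t))"
      using carrier_matD[OF A] carrier_matD[OF E[of t]] assoc_mult_mat[OF E A E, of "- t" t] by simp
    moreover have "(- (?E (- t) * (A * ?E t)) + ?E (- t) * (A * ?E t)) $$ (i, j) = 0"
      using carrier_matD[OF E[of t]] carrier_matD[OF E[of "- t"]] ij by simp
    ultimately show ?thesis by metis
  qed
  from DERIV_isconst_all[rule_format, OF this, of t 0]
  show "(?E (- t) * ?E t) $$ (i, j) = 1\<^sub>m n $$ (i, j)"
    by (simp add: mat_exp_0[OF A])
qed (use mat_exp_carrier[OF A] in \<open>auto intro: carrier_matD\<close>)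

section \<open>Forced linear equations on the half line\<close>

lemma has_real_derivative_integral_half_line:
  fixes g :: "real \<Rightarrow> real"
  assumes g: "continuous_on {0..} g" and t: "t \<ge> 0"
  shows "((\<lambda>s. integral {0..s} g) has_real_derivative g t) (at t within {0..})"
proof -
  \<comment> \<open>The fundamental theorem is applied on a compact interval. Ending it at
    \<open>t + 1\<close> keeps \<open>t\<close> away from the right endpoint, so that near
    \<open>t\<close> it looks like the half line.\<close>
  have "((\<lambda>s. integral {0..s} g) has_real_derivative g t) (at t within {0..t + 1})"
    using t by (intro integral_has_real_derivative continuous_on_subset[OF g]) auto
  moreover have "at t within {0..t + 1} = at t within {0..}"
    using t by (intro at_within_nhd[of t "{..<t + 1}"]) auto
  ultimately show ?thesis by simp
qed

text \<open>The solution is x(t) = exp(tA) (x0 + integral from 0 to t of exp(-sA) f(s) ds).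
  Continuity of the forcing makes the integral differentiable with the integrand as derivative,
  one-sided at 0.\<close>

lemma linear_ode_solution:
  fixes A :: "real mat"
  assumes A: "A \<in> carrier_mat n n" and x0: "x0 \<in> carrier_vec n"
    and f: "\<And>t. f t \<in> carrier_vec n" and cf: "\<And>i. i < n \<Longrightarrow> continuous_on {0..} (\<lambda>t. f t $ i)"
  obtains x where "x 0 = x0" "\<And>t. x t \<in> carrier_vec n"
    "\<And>t i. t \<ge> 0 \<Longrightarrow> i < n \<Longrightarrow>
      ((\<lambda>s. x s $ i) has_real_derivative (A *\<^sub>v x t + f t) $ i) (at t within {0..})"
proof -
  let ?E = "mat_exp A"
  have E: "?E t \<in> carrier_mat n n" for t using A by simp
  \<comment> \<open>In the unknown \<open>y t = mat_exp A (- t) *\<^sub>v x t\<close> the equation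
    becomes y' = g, which is integrated coordinate by coordinate.\<close>
  define g where "g t = ?E (- t) *\<^sub>v f t" for t
  have g: "g t \<in> carrier_vec n" for t unfolding g_def using E f by (rule mult_mat_vec_carrier)
  have cg: "continuous_on {0..} (\<lambda>t. g t $ i)" if i: "i < n" for i
  proof -
    have cE: "continuous_on UNIV (\<lambda>t. ?E t $$ (i, l))" if "l < n" for l
      using mat_exp_has_derivative_left[OF A i that]
      by (intro continuous_at_imp_continuous_on ballI) (rule DERIV_isCont)
    show ?thesis
      unfolding g_def index_mult_mat_vec_sum[OF E f i]
      by (intro continuous_intros cf continuous_on_compose2[OF cE]) auto
  qed
  define y where "y t = vec n (\<lambda>i. x0 $ i + integral {0..t} (\<lambda>s. g s $ i))" for t
  have y: "y t \<in> carrier_vec n" for t by (simp add: y_def)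
  have dy: "((\<lambda>s. y s $ i) has_real_derivative g t $ i) (at t within {0..})"
    if "t \<ge> 0" "i < n" for t i
    using DERIV_add[OF DERIV_const has_real_derivative_integral_half_line[OF cg[OF that(2)] that(1)]]
      that by (simp add: y_def)
  define x where "x t = ?E t *\<^sub>v y t" for t \<comment> \<open>variation of constants\<close>
  show thesis
  proof
    have "y 0 = x0" using x0 by (auto simp: y_def)
    then show "x 0 = x0" using x0 by (simp add: x_def mat_exp_0[OF A])
    show x: "x t \<in> carrier_vec n" for t unfolding x_def using E y by (rule mult_mat_vec_carrier)
    fix t :: real and i assume t: "t \<ge> 0" and i: "i < n"
    have "((\<lambda>s. x s $ i) has_real_derivative ((A * ?E t) *\<^sub>v y t + ?E t *\<^sub>v g t) $ i) (at t within {0..})"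
      unfolding x_def using A E i t
      by (intro mult_mat_vec_has_derivative[OF E y _ g] dy has_field_derivative_at_within[OF mat_exp_has_derivative_left[OF A]])
        (auto intro: mult_carrier_mat)
    moreover have "(A * ?E t) *\<^sub>v y t = A *\<^sub>v x t"
      unfolding x_def using A E y by (intro assoc_mult_mat_vec) auto
    \<comment> \<open>The inverse identity at \<open>- t\<close> gives the opposite order of the two
      exponentials, so the integrating factor cancels.\<close>
    moreover have "?E t *\<^sub>v g t = f t"
      using assoc_mult_mat_vec[OF E E f, of t "- t" t] mat_exp_minus_mult[OF A, of "- t"] f[of t]
      by (simp add: g_def)
    ultimately show "((\<lambda>s. x s $ i) has_real_derivative (A *\<^sub>v x t + f t) $ i) (at t within {0..})"
      by simp
  qed
qed

section \<open>Consistent subspaces and simulation\<close>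

lemma trajectoryD:
  assumes "trajectory \<Xi> x d" "t \<ge> 0"
  shows "x t \<in> carrier_vec (state_dim \<Xi>)" "d t \<in> carrier_vec (driving_dim \<Xi>)"
    "i < state_dim \<Xi> \<Longrightarrow> ((\<lambda>s. x s $ i) has_real_derivative
       (con_A \<Xi> *\<^sub>v x t + con_G \<Xi> *\<^sub>v d t) $ i) (at t within {0..})"
  using assms unfolding trajectory_def by auto

lemma is_con_sysD:
  assumes "is_con_sys q \<Xi>"
  shows "con_A \<Xi> \<in> carrier_mat (state_dim \<Xi>) (state_dim \<Xi>)"
    "con_G \<Xi> \<in> carrier_mat (state_dim \<Xi>) (driving_dim \<Xi>)"
    "con_C \<Xi> \<in> carrier_mat q (state_dim \<Xi>)"
    "con_H \<Xi> \<in> carrier_mat (dim_row (con_H \<Xi>)) (state_dim \<Xi>)"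
  using assms unfolding is_con_sys_def state_dim_def driving_dim_def by fastforce+

lemma is_systemD:
  assumes "is_system m p \<Sigma>"
  shows "sys_A \<Sigma> \<in> carrier_mat (dim_row (sys_A \<Sigma>)) (dim_row (sys_A \<Sigma>))"
    "sys_B \<Sigma> \<in> carrier_mat (dim_row (sys_A \<Sigma>)) m"
    "sys_G \<Sigma> \<in> carrier_mat (dim_row (sys_A \<Sigma>)) (dim_col (sys_G \<Sigma>))"
    "sys_C \<Sigma> \<in> carrier_mat p (dim_row (sys_A \<Sigma>))"
  using assms unfolding is_system_def by fastforce+

text \<open>Trajectories are unconstrained at negative times, even in dimension, so identities
  between coordinates are available only for \<open>s \<ge> 0\<close>. The derivative within the
  half line sees no more than that.\<close>

lemma has_real_derivative_half_line_cong:
  fixes f g :: "real \<Rightarrow> real"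
  assumes "t \<ge> 0" "\<And>s. s \<ge> 0 \<Longrightarrow> f s = g s"
  shows "(f has_real_derivative D) (at t within {0..}) \<longleftrightarrow> (g has_real_derivative D) (at t within {0..})"
  using assms by (intro has_field_derivative_cong_eventually) (auto simp: eventually_at_filter)

text \<open>Superposition, the source of closure of consistent subspaces under addition.\<close>

lemma trajectory_add:
  assumes sys: "is_con_sys q \<Xi>" and x: "trajectory \<Xi> x d" and y: "trajectory \<Xi> y e"
  shows "trajectory \<Xi> (\<lambda>t. x t + y t) (\<lambda>t. d t + e t)"
  unfolding trajectory_def
proof (intro allI impI conjI)
  fix t :: real assume t: "t \<ge> 0"
  let ?A = "con_A \<Xi>" and ?G = "con_G \<Xi>" and ?n = "state_dim \<Xi>"
  have xt: "x t \<in> carrier_vec ?n" "d t \<in> carrier_vec (driving_dim \<Xi>)"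
    and yt: "y t \<in> carrier_vec ?n" "e t \<in> carrier_vec (driving_dim \<Xi>)"
    using trajectoryD(1,2)[OF x t] trajectoryD(1,2)[OF y t] by auto
  show "x t + y t \<in> carrier_vec ?n" "d t + e t \<in> carrier_vec (driving_dim \<Xi>)"
    using xt yt by auto
  fix i assume i: "i < ?n"
  have "((\<lambda>s. x s $ i + y s $ i) has_real_derivative
      (?A *\<^sub>v x t + ?G *\<^sub>v d t) $ i + (?A *\<^sub>v y t + ?G *\<^sub>v e t) $ i) (at t within {0..})"
    by (intro DERIV_add trajectoryD(3)[OF x t i] trajectoryD(3)[OF y t i])
  also have "(?A *\<^sub>v x t + ?G *\<^sub>v d t) $ i + (?A *\<^sub>v y t + ?G *\<^sub>v e t) $ i =
      (?A *\<^sub>v (x t + y t) + ?G *\<^sub>v (d t + e t)) $ i"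
    using i carrier_matD(1)[OF is_con_sysD(1)[OF sys]] carrier_matD(1)[OF is_con_sysD(2)[OF sys]]
    by (simp add: mult_add_distrib_mat_vec[OF is_con_sysD(1)[OF sys] xt(1) yt(1)]
        mult_add_distrib_mat_vec[OF is_con_sysD(2)[OF sys] xt(2) yt(2)] del: index_mult_mat_vec)
  finally show "((\<lambda>s. (x s + y s) $ i) has_real_derivative
      (?A *\<^sub>v (x t + y t) + ?G *\<^sub>v (d t + e t)) $ i) (at t within {0..})"
    by (rule has_real_derivative_half_line_cong[OF t, THEN iffD1, rotated])
      (use i trajectoryD(1)[OF y] in \<open>simp add: carrier_vecD[of _ ?n]\<close>)
qed

lemma trajectory_smult:
  assumes sys: "is_con_sys q \<Xi>" and x: "trajectory \<Xi> x d"
  shows "trajectory \<Xi> (\<lambda>t. a \<cdot>\<^sub>v x t) (\<lambda>t. a \<cdot>\<^sub>v d t)"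
  unfolding trajectory_def
proof (intro allI impI conjI)
  fix t :: real assume t: "t \<ge> 0"
  let ?A = "con_A \<Xi>" and ?G = "con_G \<Xi>" and ?n = "state_dim \<Xi>"
  have xt: "x t \<in> carrier_vec ?n" "d t \<in> carrier_vec (driving_dim \<Xi>)"
    using trajectoryD(1,2)[OF x t] by auto
  then show "a \<cdot>\<^sub>v x t \<in> carrier_vec ?n" "a \<cdot>\<^sub>v d t \<in> carrier_vec (driving_dim \<Xi>)"
    by auto
  fix i assume i: "i < ?n"
  have "((\<lambda>s. a * x s $ i) has_real_derivative
      a * (?A *\<^sub>v x t + ?G *\<^sub>v d t) $ i) (at t within {0..})"
    by (intro DERIV_cmult trajectoryD(3)[OF x t i])
  also have "a * (?A *\<^sub>v x t + ?G *\<^sub>v d t) $ i = (?A *\<^sub>v (a \<cdot>\<^sub>v x t) + ?G *\<^sub>v (a \<cdot>\<^sub>v d t)) $ i"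
    using i carrier_matD(1)[OF is_con_sysD(1)[OF sys]] carrier_matD(1)[OF is_con_sysD(2)[OF sys]]
    by (simp add: mult_mat_vec[OF is_con_sysD(1)[OF sys] xt(1)] mult_mat_vec[OF is_con_sysD(2)[OF sys] xt(2)]
        distrib_left del: index_mult_mat_vec)
  finally show "((\<lambda>s. (a \<cdot>\<^sub>v x s) $ i) has_real_derivative
      (?A *\<^sub>v (a \<cdot>\<^sub>v x t) + ?G *\<^sub>v (a \<cdot>\<^sub>v d t)) $ i) (at t within {0..})"
    by (rule has_real_derivative_half_line_cong[OF t, THEN iffD1, rotated])
      (use i trajectoryD(1)[OF x] in \<open>simp add: carrier_vecD[of _ ?n]\<close>)
qed

lemma consistentE:
  assumes "x0 \<in> consistent \<Xi>"
  obtains x d where "trajectory \<Xi> x d" "x 0 = x0"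
    "\<And>t. t \<ge> 0 \<Longrightarrow> con_H \<Xi> *\<^sub>v x t = 0\<^sub>v (dim_row (con_H \<Xi>))"
  using assms unfolding consistent_def by blast

lemma consistentI:
  assumes "trajectory \<Xi> x d" "x 0 = x0"
    "\<And>t. t \<ge> 0 \<Longrightarrow> con_H \<Xi> *\<^sub>v x t = 0\<^sub>v (dim_row (con_H \<Xi>))"
  shows "x0 \<in> consistent \<Xi>"
  using assms trajectoryD(1)[OF assms(1), of 0] unfolding consistent_def by auto

lemma consistent_subset_carrier: "consistent \<Xi> \<subseteq> carrier_vec (state_dim \<Xi>)"
  unfolding consistent_def by auto

lemma consistent_add:
  assumes sys: "is_con_sys q \<Xi>" and "x0 \<in> consistent \<Xi>" "y0 \<in> consistent \<Xi>"
  shows "x0 + y0 \<in> consistent \<Xi>"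
proof -
  obtain x d where x: "trajectory \<Xi> x d" "x 0 = x0"
    "\<And>t. t \<ge> 0 \<Longrightarrow> con_H \<Xi> *\<^sub>v x t = 0\<^sub>v (dim_row (con_H \<Xi>))"
    using assms(2) by (rule consistentE) blast
  obtain y e where y: "trajectory \<Xi> y e" "y 0 = y0"
    "\<And>t. t \<ge> 0 \<Longrightarrow> con_H \<Xi> *\<^sub>v y t = 0\<^sub>v (dim_row (con_H \<Xi>))"
    using assms(3) by (rule consistentE) blast
  show ?thesis
    by (rule consistentI[OF trajectory_add[OF sys x(1) y(1)]])
      (simp_all add: x(2,3) y(2,3) mult_add_distrib_mat_vec[OF is_con_sysD(4)[OF sys]
        trajectoryD(1)[OF x(1)] trajectoryD(1)[OF y(1)]])
qed

lemma consistent_smult: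
  assumes sys: "is_con_sys q \<Xi>" and "x0 \<in> consistent \<Xi>"
  shows "a \<cdot>\<^sub>v x0 \<in> consistent \<Xi>"
proof -
  obtain x d where x: "trajectory \<Xi> x d" "x 0 = x0"
    "\<And>t. t \<ge> 0 \<Longrightarrow> con_H \<Xi> *\<^sub>v x t = 0\<^sub>v (dim_row (con_H \<Xi>))"
    using assms(2) by (rule consistentE) blast
  have "a \<cdot>\<^sub>v 0\<^sub>v k = 0\<^sub>v k" for k by (intro eq_vecI) auto
  then show ?thesis
    by (intro consistentI[OF trajectory_smult[OF sys x(1)]])
      (simp_all add: x(2,3) mult_mat_vec[OF is_con_sysD(4)[OF sys] trajectoryD(1)[OF x(1)]])
qed

lemma mult_mat_zero_vec:
  assumes "(M :: 'a :: semiring_0 mat) \<in> carrier_mat n k"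
  shows "M *\<^sub>v 0\<^sub>v k = 0\<^sub>v n"
  using assms by (intro eq_vecI) (auto simp: scalar_prod_def)

lemma zero_mat_mult_vec:
  assumes "(v :: 'a :: semiring_0 vec) \<in> carrier_vec k"
  shows "0\<^sub>m n k *\<^sub>v v = 0\<^sub>v n"
  using assms by (intro eq_vecI) (auto simp: scalar_prod_def)

lemma consistent_zero:
  assumes sys: "is_con_sys q \<Xi>"
  shows "0\<^sub>v (state_dim \<Xi>) \<in> consistent \<Xi>"
proof (rule consistentI)
  show "trajectory \<Xi> (\<lambda>_. 0\<^sub>v (state_dim \<Xi>)) (\<lambda>_. 0\<^sub>v (driving_dim \<Xi>))"
    by (simp add: trajectory_def mult_mat_zero_vec[OF is_con_sysD(1)[OF sys]]
        mult_mat_zero_vec[OF is_con_sysD(2)[OF sys]])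
qed (simp_all add: mult_mat_zero_vec[OF is_con_sysD(4)[OF sys]])

lemma subspace_prodD:
  assumes "subspace_prod n1 n2 S"
  shows "(x1, x2) \<in> S \<Longrightarrow> x1 \<in> carrier_vec n1" "(x1, x2) \<in> S \<Longrightarrow> x2 \<in> carrier_vec n2"
    "(0\<^sub>v n1, 0\<^sub>v n2) \<in> S"
    "(x1, x2) \<in> S \<Longrightarrow> (y1, y2) \<in> S \<Longrightarrow> (x1 + y1, x2 + y2) \<in> S"
    "(x1, x2) \<in> S \<Longrightarrow> (a \<cdot>\<^sub>v x1, a \<cdot>\<^sub>v x2) \<in> S"
  using assms unfolding subspace_prod_def by fast+

section \<open>Simulation is a preorder\<close>

lemma simulated_by_refl:
  assumes sys: "is_con_sys q \<Xi>"
  shows "\<Xi> \<preceq> \<Xi>"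
  unfolding simulated_by_def
proof (intro exI conjI)
  \<comment> \<open>The diagonal over the consistent subspace relates every consistent trajectory to
    itself; it is a subspace because the consistent subspace is one.\<close>
  let ?S = "(\<lambda>x. (x, x)) ` consistent \<Xi>"
  show "simulation_relation \<Xi> \<Xi> ?S"
    unfolding simulation_relation_def
  proof (intro conjI allI impI)
    show "subspace_prod (state_dim \<Xi>) (state_dim \<Xi>) ?S"
      unfolding subspace_prod_def using consistent_subset_carrier[of \<Xi>] consistent_zero[OF sys]
      by (auto intro!: imageI consistent_add[OF sys] consistent_smult[OF sys])
  next
    fix x1 d1 z2
    assume "(x1 0, z2) \<in> ?S \<and> trajectory \<Xi> x1 d1 \<and> (\<forall>t\<ge>0. x1 t \<in> consistent \<Xi>)"
    then show "\<exists>x2 d2. trajectory \<Xi> x2 d2 \<and> x2 0 = z2 \<and>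
        (\<forall>t\<ge>0. (x1 t, x2 t) \<in> ?S \<and> con_C \<Xi> *\<^sub>v x1 t = con_C \<Xi> *\<^sub>v x2 t)"
      by (intro exI[of _ x1] exI[of _ d1]) auto
  qed (simp_all add: image_image)
qed (simp add: image_image)

text \<open>Simulation relations compose as relations: a trajectory of \<open>\<Xi>1\<close> is
  answered by one of \<open>\<Xi>2\<close>, and that one by one of \<open>\<Xi>3\<close>, with equal
  outputs throughout.\<close>

lemma simulated_by_trans:
  assumes "\<Xi>1 \<preceq> \<Xi>2" "\<Xi>2 \<preceq> \<Xi>3"
  shows "\<Xi>1 \<preceq> \<Xi>3"
proof -
  from assms obtain S T where S: "simulation_relation \<Xi>1 \<Xi>2 S" "fst ` S = consistent \<Xi>1"
    and T: "simulation_relation \<Xi>2 \<Xi>3 T" "fst ` T = consistent \<Xi>2"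
    unfolding simulated_by_def by blast
  have sub: "subspace_prod (state_dim \<Xi>1) (state_dim \<Xi>2) S" "subspace_prod (state_dim \<Xi>2) (state_dim \<Xi>3) T"
    and con: "snd ` S \<subseteq> consistent \<Xi>2" "snd ` T \<subseteq> consistent \<Xi>3"
    using S(1) T(1) unfolding simulation_relation_def by auto
  have fst: "fst ` (S O T) = consistent \<Xi>1"
  proof
    show "fst ` (S O T) \<subseteq> consistent \<Xi>1" using S(2) by force
    \<comment> \<open>Here the projection of \<open>T\<close> must be all of
      \<open>consistent \<Xi>2\<close>, so that the partner \<open>y\<close> has a partner in
      turn.\<close>
    show "consistent \<Xi>1 \<subseteq> fst ` (S O T)"
    proof
      fix x assume "x \<in> consistent \<Xi>1"
      then obtain y where y: "(x, y) \<in> S" using S(2) by force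
      then have "y \<in> consistent \<Xi>2" using con by force
      then obtain z where "(y, z) \<in> T" using T(2) by force
      with y show "x \<in> fst ` (S O T)" by force
    qed
  qed
  have "simulation_relation \<Xi>1 \<Xi>3 (S O T)"
    unfolding simulation_relation_def
  proof (intro conjI allI impI)
    show "subspace_prod (state_dim \<Xi>1) (state_dim \<Xi>3) (S O T)"
      unfolding subspace_prod_def
    proof (intro conjI)
      show "S O T \<subseteq> carrier_vec (state_dim \<Xi>1) \<times> carrier_vec (state_dim \<Xi>3)"
        using subspace_prodD(1,2)[OF sub(1)] subspace_prodD(1,2)[OF sub(2)] by blast
      show "(0\<^sub>v (state_dim \<Xi>1), 0\<^sub>v (state_dim \<Xi>3)) \<in> S O T"
        using subspace_prodD(3)[OF sub(1)] subspace_prodD(3)[OF sub(2)] by (rule relcompI)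
      show "\<forall>(x1, x2)\<in>S O T. \<forall>(y1, y2)\<in>S O T. (x1 + y1, x2 + y2) \<in> S O T"
        by (auto intro: relcompI subspace_prodD(4)[OF sub(1)] subspace_prodD(4)[OF sub(2)])
      show "\<forall>a. \<forall>(x1, x2)\<in>S O T. (a \<cdot>\<^sub>v x1, a \<cdot>\<^sub>v x2) \<in> S O T"
        by (auto intro: relcompI subspace_prodD(5)[OF sub(1)] subspace_prodD(5)[OF sub(2)])
    qed
    show "fst ` (S O T) \<subseteq> consistent \<Xi>1" using fst by simp
    show "snd ` (S O T) \<subseteq> consistent \<Xi>3" using con by force
    fix x1 d1 z3
    assume asm: "(x1 0, z3) \<in> S O T \<and> trajectory \<Xi>1 x1 d1 \<and> (\<forall>t\<ge>0. x1 t \<in> consistent \<Xi>1)"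
    then obtain z2 where z2: "(x1 0, z2) \<in> S" "(z2, z3) \<in> T" by blast
    obtain x2 d2 where x2: "trajectory \<Xi>2 x2 d2" "x2 0 = z2"
      "\<forall>t\<ge>0. (x1 t, x2 t) \<in> S \<and> con_C \<Xi>1 *\<^sub>v x1 t = con_C \<Xi>2 *\<^sub>v x2 t"
      using S(1) asm z2(1) unfolding simulation_relation_def by blast
    \<comment> \<open>The second simulation answers only trajectories that stay consistent. The
      first one guarantees this, as its pairs have consistent second components.\<close>
    then have "\<forall>t\<ge>0. x2 t \<in> consistent \<Xi>2" using con by force
    then obtain x3 d3 where "trajectory \<Xi>3 x3 d3" "x3 0 = z3"
      "\<forall>t\<ge>0. (x2 t, x3 t) \<in> T \<and> con_C \<Xi>2 *\<^sub>v x2 t = con_C \<Xi>3 *\<^sub>v x3 t"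
      using T(1) x2(1,2) z2(2) unfolding simulation_relation_def by blast
    with x2 show "\<exists>x3 d3. trajectory \<Xi>3 x3 d3 \<and> x3 0 = z3 \<and>
        (\<forall>t\<ge>0. (x1 t, x3 t) \<in> S O T \<and> con_C \<Xi>1 *\<^sub>v x1 t = con_C \<Xi>3 *\<^sub>v x3 t)"
      by (intro exI[of _ x3] exI[of _ d3]) (auto intro: relcompI)
  qed
  with fst show ?thesis unfolding simulated_by_def by blast
qed

section \<open>Interconnection with a system\<close>

text \<open>The input is a parameter, so that the same \<open>x\<close> and \<open>d\<close> can be
  attached to any environment producing that input. The summands are ordered as in the lower block
  row of \<open>E \<and>\<^sub>s \<Sigma>\<close>.\<close>

definition sys_trajectory ::
  "lin_sys \<Rightarrow> (real \<Rightarrow> real vec) \<Rightarrow> (real \<Rightarrow> real vec) \<Rightarrow> (real \<Rightarrow> real vec) \<Rightarrow> bool" where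
  "sys_trajectory \<Sigma> u x d \<longleftrightarrow>
     (\<forall>t\<ge>0. x t \<in> carrier_vec (dim_row (sys_A \<Sigma>)) \<and> d t \<in> carrier_vec (dim_col (sys_G \<Sigma>)) \<and>
       (\<forall>i<dim_row (sys_A \<Sigma>). ((\<lambda>s. x s $ i) has_real_derivative
          (sys_B \<Sigma> *\<^sub>v u t + sys_A \<Sigma> *\<^sub>v x t + sys_G \<Sigma> *\<^sub>v d t) $ i) (at t within {0..})))"

lemma state_dim_interconnection [simp]:
  "state_dim (E \<and>\<^sub>s \<Sigma>) = state_dim E + dim_row (sys_A \<Sigma>)"
  by (simp add: interconnection_def state_dim_def Let_def)

lemma driving_dim_interconnection [simp]:
  "driving_dim (E \<and>\<^sub>s \<Sigma>) = driving_dim E + dim_col (sys_G \<Sigma>)"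
  by (simp add: interconnection_def driving_dim_def Let_def)

section \<open>Block form of the interconnection and its trajectories\<close>

context
  fixes m p :: nat and E :: con_sys and \<Sigma> :: lin_sys
  assumes E: "is_con_sys m E" and \<Sigma>: "is_system m p \<Sigma>"
begin

text \<open>The upper right block vanishes because \<open>\<Sigma>\<close> does not feed back into
  \<open>E\<close>; reassociating the lower left block exhibits the output of \<open>E\<close> as
  the input of \<open>\<Sigma>\<close>.\<close>

lemma con_A_interconnection:
  assumes xe: "xe \<in> carrier_vec (state_dim E)" and x: "x \<in> carrier_vec (dim_row (sys_A \<Sigma>))"
  shows "con_A (E \<and>\<^sub>s \<Sigma>) *\<^sub>v (xe @\<^sub>v x) =
    (con_A E *\<^sub>v xe) @\<^sub>v (sys_B \<Sigma> *\<^sub>v (con_C E *\<^sub>v xe) + sys_A \<Sigma> *\<^sub>v x)"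
proof -
  have "con_A (E \<and>\<^sub>s \<Sigma>) *\<^sub>v (xe @\<^sub>v x) =
      (con_A E *\<^sub>v xe + 0\<^sub>m (state_dim E) (dim_row (sys_A \<Sigma>)) *\<^sub>v x) @\<^sub>v
      ((sys_B \<Sigma> * con_C E) *\<^sub>v xe + sys_A \<Sigma> *\<^sub>v x)"
    unfolding interconnection_def Let_def con_sys.simps state_dim_def[symmetric]
    by (rule four_block_mat_mult_vec[OF is_con_sysD(1)[OF E] zero_carrier_mat
          mult_carrier_mat[OF is_systemD(2)[OF \<Sigma>] is_con_sysD(3)[OF E]] is_systemD(1)[OF \<Sigma>] xe x])
  also have "con_A E *\<^sub>v xe + 0\<^sub>m (state_dim E) (dim_row (sys_A \<Sigma>)) *\<^sub>v x = con_A E *\<^sub>v xe"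
    using mult_mat_vec_carrier[OF is_con_sysD(1)[OF E] xe] zero_mat_mult_vec[OF x] by simp
  finally show ?thesis
    by (simp only: assoc_mult_mat_vec[OF is_systemD(2)[OF \<Sigma>] is_con_sysD(3)[OF E] xe])
qed

lemma con_G_interconnection:
  assumes de: "de \<in> carrier_vec (driving_dim E)" and d: "d \<in> carrier_vec (dim_col (sys_G \<Sigma>))"
  shows "con_G (E \<and>\<^sub>s \<Sigma>) *\<^sub>v (de @\<^sub>v d) = (con_G E *\<^sub>v de) @\<^sub>v (sys_G \<Sigma> *\<^sub>v d)"
proof -
  have "con_G (E \<and>\<^sub>s \<Sigma>) *\<^sub>v (de @\<^sub>v d) =
      (con_G E *\<^sub>v de + 0\<^sub>m (state_dim E) (dim_col (sys_G \<Sigma>)) *\<^sub>v d) @\<^sub>v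
      (0\<^sub>m (dim_row (sys_A \<Sigma>)) (driving_dim E) *\<^sub>v de + sys_G \<Sigma> *\<^sub>v d)"
    unfolding interconnection_def Let_def con_sys.simps state_dim_def[symmetric] driving_dim_def[symmetric]
    by (rule four_block_mat_mult_vec[OF is_con_sysD(2)[OF E] zero_carrier_mat zero_carrier_mat
          is_systemD(3)[OF \<Sigma>] de d])
  then show ?thesis
    using mult_mat_vec_carrier[OF is_con_sysD(2)[OF E] de] mult_mat_vec_carrier[OF is_systemD(3)[OF \<Sigma>] d]
      zero_mat_mult_vec[OF de] zero_mat_mult_vec[OF d] by simp
qed

lemma con_C_interconnection:
  assumes xe: "xe \<in> carrier_vec (state_dim E)" and x: "x \<in> carrier_vec (dim_row (sys_A \<Sigma>))"
  shows "con_C (E \<and>\<^sub>s \<Sigma>) *\<^sub>v (xe @\<^sub>v x) = (con_C E *\<^sub>v xe) @\<^sub>v (sys_C \<Sigma> *\<^sub>v x)"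
proof -
  have "con_C (E \<and>\<^sub>s \<Sigma>) *\<^sub>v (xe @\<^sub>v x) =
      (con_C E *\<^sub>v xe + 0\<^sub>m m (dim_row (sys_A \<Sigma>)) *\<^sub>v x) @\<^sub>v
      (0\<^sub>m p (state_dim E) *\<^sub>v xe + sys_C \<Sigma> *\<^sub>v x)"
    unfolding interconnection_def Let_def con_sys.simps state_dim_def[symmetric]
      carrier_matD(1)[OF is_con_sysD(3)[OF E]] carrier_matD(1)[OF is_systemD(4)[OF \<Sigma>]]
    by (rule four_block_mat_mult_vec[OF is_con_sysD(3)[OF E] zero_carrier_mat zero_carrier_mat
          is_systemD(4)[OF \<Sigma>] xe x])
  then show ?thesis
    using mult_mat_vec_carrier[OF is_con_sysD(3)[OF E] xe] mult_mat_vec_carrier[OF is_systemD(4)[OF \<Sigma>] x]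
      zero_mat_mult_vec[OF xe] zero_mat_mult_vec[OF x] by simp
qed

text \<open>The lower blocks have no rows, so they append only the empty vector, and the zero block
  beside \<open>con_H E\<close> annihilates \<open>x\<close>.\<close>

lemma con_H_interconnection:
  assumes xe: "xe \<in> carrier_vec (state_dim E)" and x: "x \<in> carrier_vec (dim_row (sys_A \<Sigma>))"
  shows "con_H (E \<and>\<^sub>s \<Sigma>) *\<^sub>v (xe @\<^sub>v x) = 0\<^sub>v (dim_row (con_H (E \<and>\<^sub>s \<Sigma>))) \<longleftrightarrow>
    con_H E *\<^sub>v xe = 0\<^sub>v (dim_row (con_H E))"
proof -
  have "con_H (E \<and>\<^sub>s \<Sigma>) *\<^sub>v (xe @\<^sub>v x) =
      (con_H E *\<^sub>v xe + 0\<^sub>m (dim_row (con_H E)) (dim_row (sys_A \<Sigma>)) *\<^sub>v x) @\<^sub>v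
      (0\<^sub>m 0 (state_dim E) *\<^sub>v xe + 0\<^sub>m 0 (dim_row (sys_A \<Sigma>)) *\<^sub>v x)"
    unfolding interconnection_def Let_def con_sys.simps state_dim_def[symmetric]
    by (rule four_block_mat_mult_vec[OF is_con_sysD(4)[OF E] zero_carrier_mat zero_carrier_mat
          zero_carrier_mat xe x])
  also have "\<dots> = con_H E *\<^sub>v xe"
    by (intro eq_vecI) (use x in auto)
  finally show ?thesis
    by (simp add: interconnection_def Let_def)
qed

text \<open>Coordinates below \<open>state_dim E\<close> belong to the environment, the others to
  \<open>\<Sigma>\<close>. \<open>z\<close> is kept apart from the concatenation and compared with
  it only for \<open>t \<ge> 0\<close>, so that the equivalence serves both to split a given
  trajectory and to join two.\<close>

lemma trajectory_interconnection_iff: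
  assumes xe: "\<And>t. t \<ge> 0 \<Longrightarrow> xe t \<in> carrier_vec (state_dim E)"
    and de: "\<And>t. t \<ge> 0 \<Longrightarrow> de t \<in> carrier_vec (driving_dim E)"
    and x: "\<And>t. t \<ge> 0 \<Longrightarrow> x t \<in> carrier_vec (dim_row (sys_A \<Sigma>))"
    and d: "\<And>t. t \<ge> 0 \<Longrightarrow> d t \<in> carrier_vec (dim_col (sys_G \<Sigma>))"
    and z: "\<And>t. t \<ge> 0 \<Longrightarrow> z t = xe t @\<^sub>v x t" and dz: "\<And>t. t \<ge> 0 \<Longrightarrow> dz t = de t @\<^sub>v d t"
  shows "trajectory (E \<and>\<^sub>s \<Sigma>) z dz \<longleftrightarrow>
    trajectory E xe de \<and> sys_trajectory \<Sigma> (\<lambda>t. con_C E *\<^sub>v xe t) x d"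
proof -
  let ?n = "state_dim E" and ?m = "dim_row (sys_A \<Sigma>)"
  let ?fe = "\<lambda>t. con_A E *\<^sub>v xe t + con_G E *\<^sub>v de t"
  let ?f = "\<lambda>t. sys_B \<Sigma> *\<^sub>v (con_C E *\<^sub>v xe t) + sys_A \<Sigma> *\<^sub>v x t + sys_G \<Sigma> *\<^sub>v d t"
  let ?F = "\<lambda>t. con_A (E \<and>\<^sub>s \<Sigma>) *\<^sub>v z t + con_G (E \<and>\<^sub>s \<Sigma>) *\<^sub>v dz t"
  have split: "(\<forall>i<?n + ?m. P i) \<longleftrightarrow> (\<forall>i<?n. P i) \<and> (\<forall>i<?m. P (?n + i))" for P
  proof (intro iffI conjI allI impI)
    fix i assume "(\<forall>i<?n. P i) \<and> (\<forall>i<?m. P (?n + i))" "i < ?n + ?m"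
    then show "P i" by (cases "i < ?n") (auto dest: spec[of _ "i - ?n"])
  qed auto
  \<comment> \<open>At each fixed time the two groups of coordinates decouple once the right-hand
    side is written as a concatenation too.\<close>
  have deriv: "(\<forall>i<?n + ?m. ((\<lambda>s. z s $ i) has_real_derivative ?F t $ i) (at t within {0..})) \<longleftrightarrow>
      (\<forall>i<?n. ((\<lambda>s. xe s $ i) has_real_derivative ?fe t $ i) (at t within {0..})) \<and>
      (\<forall>i<?m. ((\<lambda>s. x s $ i) has_real_derivative ?f t $ i) (at t within {0..}))"
    if t: "t \<ge> 0" for t
  proof -
    note carrier = mult_mat_vec_carrier[OF is_con_sysD(1)[OF E] xe[OF t]]
      mult_mat_vec_carrier[OF is_con_sysD(2)[OF E] de[OF t]]
      add_carrier_vec[OF mult_mat_vec_carrier[OF is_systemD(2)[OF \<Sigma>] mult_mat_vec_carrier[OF is_con_sysD(3)[OF E] xe[OF t]]]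
        mult_mat_vec_carrier[OF is_systemD(1)[OF \<Sigma>] x[OF t]]]
      mult_mat_vec_carrier[OF is_systemD(3)[OF \<Sigma>] d[OF t]]
    have F: "?F t = ?fe t @\<^sub>v ?f t"
      unfolding z[OF t] dz[OF t] con_A_interconnection[OF xe[OF t] x[OF t]]
        con_G_interconnection[OF de[OF t] d[OF t]]
      by (rule append_vec_add[OF carrier])
    have fe: "dim_vec (?fe t) = ?n" and f: "dim_vec (?f t) = ?m"
      using carrier_vecD[OF add_carrier_vec[OF carrier(1,2)]] carrier_vecD[OF add_carrier_vec[OF carrier(3,4)]]
      by this
    have "((\<lambda>s. z s $ i) has_real_derivative ?F t $ i) (at t within {0..}) \<longleftrightarrow>
       ((\<lambda>s. xe s $ i) has_real_derivative ?fe t $ i) (at t within {0..})" if i: "i < ?n" for i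
    proof -
      have "?F t $ i = ?fe t $ i"
        unfolding F using i by (simp only: index_append_vec(1) fe f trans_less_add1 if_True)
      moreover have "z s $ i = xe s $ i" if "s \<ge> 0" for s
        using i carrier_vecD[OF xe[OF that]] by (simp add: z[OF that])
      ultimately show ?thesis
        by (simp only:) (rule has_real_derivative_half_line_cong[OF t])
    qed
    moreover have "((\<lambda>s. z s $ (?n + i)) has_real_derivative ?F t $ (?n + i)) (at t within {0..}) \<longleftrightarrow>
       ((\<lambda>s. x s $ i) has_real_derivative ?f t $ i) (at t within {0..})" if i: "i < ?m" for i
    proof -
      have "?F t $ (?n + i) = ?f t $ i"
        unfolding F using i by (simp only: index_append_vec(1) fe f nat_add_left_cancel_less
          not_add_less1 if_False diff_add_inverse)
      moreover have "z s $ (?n + i) = x s $ i" if "s \<ge> 0" for s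
        using i carrier_vecD[OF xe[OF that]] carrier_vecD[OF x[OF that]] by (simp add: z[OF that])
      ultimately show ?thesis
        by (simp only:) (rule has_real_derivative_half_line_cong[OF t])
    qed
    ultimately show ?thesis unfolding split by blast
  qed
  have "z t \<in> carrier_vec (?n + ?m)" "dz t \<in> carrier_vec (driving_dim E + dim_col (sys_G \<Sigma>))"
    if t: "t \<ge> 0" for t
    using append_carrier_vec[OF xe[OF t] x[OF t]] append_carrier_vec[OF de[OF t] d[OF t]]
    by (simp_all only: z[OF t] dz[OF t])
  then have "trajectory (E \<and>\<^sub>s \<Sigma>) z dz \<longleftrightarrow> (\<forall>t\<ge>0.
      \<forall>i<?n + ?m. ((\<lambda>s. z s $ i) has_real_derivative ?F t $ i) (at t within {0..}))"
    unfolding trajectory_def state_dim_interconnection driving_dim_interconnection by blast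
  also have "\<dots> \<longleftrightarrow> (\<forall>t\<ge>0.
      (\<forall>i<?n. ((\<lambda>s. xe s $ i) has_real_derivative ?fe t $ i) (at t within {0..})) \<and>
      (\<forall>i<?m. ((\<lambda>s. x s $ i) has_real_derivative ?f t $ i) (at t within {0..})))"
    using deriv by blast
  also have "\<dots> \<longleftrightarrow> trajectory E xe de \<and> sys_trajectory \<Sigma> (\<lambda>t. con_C E *\<^sub>v xe t) x d"
    unfolding trajectory_def sys_trajectory_def using xe de x d by blast
  finally show ?thesis .
qed

lemma trajectory_interconnectionE:
  assumes "trajectory (E \<and>\<^sub>s \<Sigma>) z dz"
  obtains xe de x d where "trajectory E xe de" "sys_trajectory \<Sigma> (\<lambda>t. con_C E *\<^sub>v xe t) x d"
    "\<And>t. t \<ge> 0 \<Longrightarrow> z t = xe t @\<^sub>v x t"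
proof -
  let ?n = "state_dim E" and ?m = "dim_row (sys_A \<Sigma>)" and ?k = "driving_dim E" and ?l = "dim_col (sys_G \<Sigma>)"
  have z: "z t = vec_first (z t) ?n @\<^sub>v vec_last (z t) ?m" "dz t = vec_first (dz t) ?k @\<^sub>v vec_last (dz t) ?l"
    if "t \<ge> 0" for t
    using trajectoryD(1,2)[OF assms that] by simp_all
  have "trajectory E (\<lambda>t. vec_first (z t) ?n) (\<lambda>t. vec_first (dz t) ?k) \<and>
    sys_trajectory \<Sigma> (\<lambda>t. con_C E *\<^sub>v vec_first (z t) ?n) (\<lambda>t. vec_last (z t) ?m) (\<lambda>t. vec_last (dz t) ?l)"
    using assms by (subst (asm) trajectory_interconnection_iff[OF _ _ _ _ z]) auto
  with z(1) show thesis using that by blast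
qed

text \<open>\<open>de\<close> may be irregular, but \<open>xe\<close> is differentiable, hence
  continuous, and so is the input it produces. With driving variable zero, \<open>\<Sigma>\<close>
  is then a linear equation with continuous forcing.\<close>

lemma sys_trajectory_exists:
  assumes xe: "trajectory E xe de" and x0: "x0 \<in> carrier_vec (dim_row (sys_A \<Sigma>))"
  obtains x d where "sys_trajectory \<Sigma> (\<lambda>t. con_C E *\<^sub>v xe t) x d" "x 0 = x0"
proof -
  let ?n = "dim_row (sys_A \<Sigma>)"
  \<comment> \<open>\<open>linear_ode_solution\<close> asks for a forcing of the right dimension at
    all times; \<open>xe\<close> is controlled only for \<open>t \<ge> 0\<close>, so the zero vector
    replaces it before.\<close>
  define f where "f t = sys_B \<Sigma> *\<^sub>v (con_C E *\<^sub>v (if t \<ge> 0 then xe t else 0\<^sub>v (state_dim E)))" for t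
  have B: "sys_B \<Sigma> * con_C E \<in> carrier_mat ?n (state_dim E)"
    using is_con_sysD(3)[OF E] is_systemD(2)[OF \<Sigma>] by simp
  have f_eq: "f t = (sys_B \<Sigma> * con_C E) *\<^sub>v xe t" if "t \<ge> 0" for t
    unfolding f_def using that is_con_sysD(3)[OF E] is_systemD(2)[OF \<Sigma>] trajectoryD(1)[OF xe that]
    by (simp add: assoc_mult_mat_vec)
  have f: "f t \<in> carrier_vec ?n" for t
    unfolding f_def using is_con_sysD(3)[OF E] is_systemD(2)[OF \<Sigma>] trajectoryD(1)[OF xe, of t]
    by (auto intro!: mult_mat_vec_carrier)
  have cxe: "continuous_on {0..} (\<lambda>t. xe t $ j)" if "j < state_dim E" for j
    using trajectoryD(3)[OF xe _ that] by (intro DERIV_continuous_on) auto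
  have cf: "continuous_on {0..} (\<lambda>t. f t $ i)" if i: "i < ?n" for i
  proof -
    have "continuous_on {0..} (\<lambda>t. \<Sum>l\<in>{0..<state_dim E}. (sys_B \<Sigma> * con_C E) $$ (i, l) * xe t $ l)"
      by (intro continuous_intros cxe) auto
    also have "?this \<longleftrightarrow> ?thesis"
      using index_mult_mat_vec_sum[OF B trajectoryD(1)[OF xe] i]
      by (intro continuous_on_cong refl) (simp add: f_eq)
    finally show ?thesis .
  qed
  obtain x where x: "x 0 = x0" "\<And>t. x t \<in> carrier_vec ?n"
    "\<And>t i. t \<ge> 0 \<Longrightarrow> i < ?n \<Longrightarrow>
      ((\<lambda>s. x s $ i) has_real_derivative (sys_A \<Sigma> *\<^sub>v x t + f t) $ i) (at t within {0..})"
    by (rule linear_ode_solution[OF is_systemD(1)[OF \<Sigma>] x0 f cf]) (assumption, blast)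
  have "sys_trajectory \<Sigma> (\<lambda>t. con_C E *\<^sub>v xe t) x (\<lambda>_. 0\<^sub>v (dim_col (sys_G \<Sigma>)))"
    unfolding sys_trajectory_def
  proof (intro allI impI conjI)
    fix t :: real and i assume t: "t \<ge> 0" and i: "i < ?n"
    have "sys_G \<Sigma> *\<^sub>v 0\<^sub>v (dim_col (sys_G \<Sigma>)) = 0\<^sub>v ?n"
      by (rule mult_mat_zero_vec[OF is_systemD(3)[OF \<Sigma>]])
    moreover have "sys_A \<Sigma> *\<^sub>v x t \<in> carrier_vec ?n"
      using is_systemD(1)[OF \<Sigma>] x(2) by (rule mult_mat_vec_carrier)
    ultimately have "sys_B \<Sigma> *\<^sub>v (con_C E *\<^sub>v xe t) + sys_A \<Sigma> *\<^sub>v x t + sys_G \<Sigma> *\<^sub>v 0\<^sub>v (dim_col (sys_G \<Sigma>)) =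
        sys_A \<Sigma> *\<^sub>v x t + f t"
      using f[of t] t comm_add_vec[of "f t" ?n] by (simp add: f_def)
    with x(3)[OF t i] show "((\<lambda>s. x s $ i) has_real_derivative (sys_B \<Sigma> *\<^sub>v (con_C E *\<^sub>v xe t) +
        sys_A \<Sigma> *\<^sub>v x t + sys_G \<Sigma> *\<^sub>v 0\<^sub>v (dim_col (sys_G \<Sigma>))) $ i) (at t within {0..})"
      by simp
  qed (simp_all add: x(2))
  then show thesis using x(1) by (rule that)
qed

text \<open>The constraint binds only the environment part, and the state of \<open>\<Sigma>\<close>
  can start anywhere because \<open>\<Sigma>\<close> has a trajectory for the input that a
  consistent \<open>xe\<close> produces.\<close>

lemma consistent_interconnection:
  "consistent (E \<and>\<^sub>s \<Sigma>) = (\<lambda>(xe, x). xe @\<^sub>v x) ` (consistent E \<times> carrier_vec (dim_row (sys_A \<Sigma>)))"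
proof (intro subset_antisym subsetI)
  fix z0 assume "z0 \<in> consistent (E \<and>\<^sub>s \<Sigma>)"
  then obtain z dz where z: "trajectory (E \<and>\<^sub>s \<Sigma>) z dz" "z 0 = z0"
    "\<And>t. t \<ge> 0 \<Longrightarrow> con_H (E \<and>\<^sub>s \<Sigma>) *\<^sub>v z t = 0\<^sub>v (dim_row (con_H (E \<and>\<^sub>s \<Sigma>)))"
    by (rule consistentE) blast
  obtain xe de x d where xe: "trajectory E xe de" and x: "sys_trajectory \<Sigma> (\<lambda>t. con_C E *\<^sub>v xe t) x d"
    and zx: "\<And>t. t \<ge> 0 \<Longrightarrow> z t = xe t @\<^sub>v x t"
    by (rule trajectory_interconnectionE[OF z(1)]) (rule that, simp_all)
  have xc: "x t \<in> carrier_vec (dim_row (sys_A \<Sigma>))" if "t \<ge> 0" for t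
    using x that unfolding sys_trajectory_def by blast
  have "con_H E *\<^sub>v xe t = 0\<^sub>v (dim_row (con_H E))" if t: "t \<ge> 0" for t
    using z(3)[OF t] con_H_interconnection[OF trajectoryD(1)[OF xe t] xc[OF t]] by (simp only: zx[OF t])
  then have "xe 0 \<in> consistent E" by (rule consistentI[OF xe refl])
  moreover have "z0 = xe 0 @\<^sub>v x 0" using zx[of 0] z(2) by simp
  ultimately show "z0 \<in> (\<lambda>(xe, x). xe @\<^sub>v x) ` (consistent E \<times> carrier_vec (dim_row (sys_A \<Sigma>)))"
    using xc[of 0] by (intro image_eqI[of _ _ "(xe 0, x 0)"]) simp_all
next
  fix z0 assume "z0 \<in> (\<lambda>(xe, x). xe @\<^sub>v x) ` (consistent E \<times> carrier_vec (dim_row (sys_A \<Sigma>)))"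
  then obtain xe0 x0 where xe0: "xe0 \<in> consistent E" and x0: "x0 \<in> carrier_vec (dim_row (sys_A \<Sigma>))"
    and z0: "z0 = xe0 @\<^sub>v x0" by auto
  obtain xe de where xe: "trajectory E xe de" "xe 0 = xe0"
    "\<And>t. t \<ge> 0 \<Longrightarrow> con_H E *\<^sub>v xe t = 0\<^sub>v (dim_row (con_H E))"
    using xe0 by (rule consistentE) blast
  obtain x d where x: "sys_trajectory \<Sigma> (\<lambda>t. con_C E *\<^sub>v xe t) x d" "x 0 = x0"
    by (rule sys_trajectory_exists[OF xe(1) x0]) (rule that)
  have xc: "x t \<in> carrier_vec (dim_row (sys_A \<Sigma>))" "d t \<in> carrier_vec (dim_col (sys_G \<Sigma>))" if "t \<ge> 0" for t
    using x that unfolding sys_trajectory_def by blast+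
  have "trajectory (E \<and>\<^sub>s \<Sigma>) (\<lambda>t. xe t @\<^sub>v x t) (\<lambda>t. de t @\<^sub>v d t)"
    by (rule trajectory_interconnection_iff[where xe = xe and de = de and x = x and d = d, THEN iffD2])
      (simp_all add: trajectoryD(1,2)[OF xe(1)] xc xe(1) x(1))
  then show "z0 \<in> consistent (E \<and>\<^sub>s \<Sigma>)"
  proof (rule consistentI)
    show "con_H (E \<and>\<^sub>s \<Sigma>) *\<^sub>v (xe t @\<^sub>v x t) = 0\<^sub>v (dim_row (con_H (E \<and>\<^sub>s \<Sigma>)))" if t: "t \<ge> 0" for t
      using xe(3)[OF t] con_H_interconnection[OF trajectoryD(1)[OF xe(1) t] xc(1)[OF t]] by simp
  qed (simp add: xe(2) x(2) z0)
qed

end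

section \<open>Monotonicity of interconnection under simulation\<close>

lemma interconnection_mono:
  assumes E: "is_con_sys m E" and A: "is_con_sys m A" and \<Sigma>: "is_system m p \<Sigma>"
    and EA: "E \<preceq> A"
  shows "E \<and>\<^sub>s \<Sigma> \<preceq> A \<and>\<^sub>s \<Sigma>"
proof -
  obtain S where S: "simulation_relation E A S" "fst ` S = consistent E"
    using EA unfolding simulated_by_def by blast
  have sub: "subspace_prod (state_dim E) (state_dim A) S" and snd: "snd ` S \<subseteq> consistent A"
    using S(1) unfolding simulation_relation_def by auto
  let ?n = "dim_row (sys_A \<Sigma>)"
  have Sc: "xe \<in> carrier_vec (state_dim E)" "xa \<in> carrier_vec (state_dim A)" if "(xe, xa) \<in> S" for xe xa
    using subspace_prodD(1,2)[OF sub that] by auto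
  \<comment> \<open>Both sides carry the same state of \<open>\<Sigma>\<close>; only the environment
    states are exchanged along \<open>S\<close>.\<close>
  define T where "T = {(xe @\<^sub>v x, xa @\<^sub>v x) | xe xa x. (xe, xa) \<in> S \<and> x \<in> carrier_vec ?n}"
  have TI: "(xe @\<^sub>v x, xa @\<^sub>v x) \<in> T" if "(xe, xa) \<in> S" "x \<in> carrier_vec ?n" for xe xa x
    using that unfolding T_def by blast
  have TE: thesis if "w \<in> T" "\<And>xe xa x. w = (xe @\<^sub>v x, xa @\<^sub>v x) \<Longrightarrow> (xe, xa) \<in> S \<Longrightarrow> x \<in> carrier_vec ?n \<Longrightarrow> thesis"
    for w thesis
    using that unfolding T_def by blast
  \<comment> \<open>Equality holds because \<open>S\<close> projects onto all of
    \<open>consistent E\<close> and the state of \<open>\<Sigma>\<close> is free on both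
    sides.\<close>
  have fst_T: "fst ` T = consistent (E \<and>\<^sub>s \<Sigma>)"
    unfolding consistent_interconnection[OF E \<Sigma>] S(2)[symmetric] T_def by force
  have snd_T: "snd ` T \<subseteq> consistent (A \<and>\<^sub>s \<Sigma>)"
    using snd unfolding consistent_interconnection[OF A \<Sigma>] T_def by force
  have "simulation_relation (E \<and>\<^sub>s \<Sigma>) (A \<and>\<^sub>s \<Sigma>) T"
    unfolding simulation_relation_def
  proof (intro conjI allI impI)
    show "subspace_prod (state_dim (E \<and>\<^sub>s \<Sigma>)) (state_dim (A \<and>\<^sub>s \<Sigma>)) T"
      unfolding subspace_prod_def
    proof (intro conjI ballI allI)
      show "T \<subseteq> carrier_vec (state_dim (E \<and>\<^sub>s \<Sigma>)) \<times> carrier_vec (state_dim (A \<and>\<^sub>s \<Sigma>))"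
        using Sc by (auto elim!: TE)
      have "(0\<^sub>v (state_dim E), 0\<^sub>v (state_dim A)) \<in> S"
        by (rule subspace_prodD(3)[OF sub])
      then have "(0\<^sub>v (state_dim E) @\<^sub>v 0\<^sub>v ?n, 0\<^sub>v (state_dim A) @\<^sub>v 0\<^sub>v ?n) \<in> T"
        by (intro TI) auto
      moreover have "0\<^sub>v k @\<^sub>v 0\<^sub>v ?n = (0\<^sub>v (k + ?n) :: real vec)" for k by (intro eq_vecI) auto
      ultimately show "(0\<^sub>v (state_dim (E \<and>\<^sub>s \<Sigma>)), 0\<^sub>v (state_dim (A \<and>\<^sub>s \<Sigma>))) \<in> T"
        by simp
      show "case v of (x1, x2) \<Rightarrow> \<forall>(y1, y2)\<in>T. (x1 + y1, x2 + y2) \<in> T" if "v \<in> T" for v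
        using that
      proof (rule TE)
        fix xe xa x assume v: "v = (xe @\<^sub>v x, xa @\<^sub>v x)" "(xe, xa) \<in> S" "x \<in> carrier_vec ?n"
        have "((xe @\<^sub>v x) + y1, (xa @\<^sub>v x) + y2) \<in> T" if "(y1, y2) \<in> T" for y1 y2
          using that
        proof (rule TE)
          fix ye ya y assume y: "(y1, y2) = (ye @\<^sub>v y, ya @\<^sub>v y)" "(ye, ya) \<in> S" "y \<in> carrier_vec ?n"
          have "(xe + ye, xa + ya) \<in> S"
            by (rule subspace_prodD(4)[OF sub v(2) y(2)])
          then have "((xe + ye) @\<^sub>v (x + y), (xa + ya) @\<^sub>v (x + y)) \<in> T"
            using v(3) y(3) by (intro TI) auto
          then show ?thesis
            using y(1) by (simp add: append_vec_add[OF Sc(1)[OF v(2)] Sc(1)[OF y(2)] v(3) y(3)]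
                append_vec_add[OF Sc(2)[OF v(2)] Sc(2)[OF y(2)] v(3) y(3)])
        qed
        then show ?thesis using v(1) by blast
      qed
      show "case v of (x1, x2) \<Rightarrow> (a \<cdot>\<^sub>v x1, a \<cdot>\<^sub>v x2) \<in> T" if "v \<in> T" for a v
        using that
      proof (rule TE)
        fix xe xa x assume v: "v = (xe @\<^sub>v x, xa @\<^sub>v x)" "(xe, xa) \<in> S" "x \<in> carrier_vec ?n"
        have "(a \<cdot>\<^sub>v xe, a \<cdot>\<^sub>v xa) \<in> S"
          by (rule subspace_prodD(5)[OF sub v(2)])
        then have "((a \<cdot>\<^sub>v xe) @\<^sub>v (a \<cdot>\<^sub>v x), (a \<cdot>\<^sub>v xa) @\<^sub>v (a \<cdot>\<^sub>v x)) \<in> T"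
          using v(3) by (intro TI) auto
        moreover have "a \<cdot>\<^sub>v (u @\<^sub>v x) = (a \<cdot>\<^sub>v u) @\<^sub>v (a \<cdot>\<^sub>v x)" for u by (intro eq_vecI) auto
        ultimately show ?thesis using v(1) by simp
      qed
    qed
    show "fst ` T \<subseteq> consistent (E \<and>\<^sub>s \<Sigma>)" using fst_T by simp
    show "snd ` T \<subseteq> consistent (A \<and>\<^sub>s \<Sigma>)" by (rule snd_T)
    fix z1 dz1 z2
    assume asm: "(z1 0, z2) \<in> T \<and> trajectory (E \<and>\<^sub>s \<Sigma>) z1 dz1 \<and> (\<forall>t\<ge>0. z1 t \<in> consistent (E \<and>\<^sub>s \<Sigma>))"
    then have "trajectory (E \<and>\<^sub>s \<Sigma>) z1 dz1" by simp
    then obtain xe de x d where xe: "trajectory E xe de" and x: "sys_trajectory \<Sigma> (\<lambda>t. con_C E *\<^sub>v xe t) x d"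
      and z1: "\<And>t. t \<ge> 0 \<Longrightarrow> z1 t = xe t @\<^sub>v x t"
      by (rule trajectory_interconnectionE[OF E \<Sigma>]) (rule that, simp_all)
    have xc: "x t \<in> carrier_vec ?n" "d t \<in> carrier_vec (dim_col (sys_G \<Sigma>))" if "t \<ge> 0" for t
      using x that unfolding sys_trajectory_def by blast+
    \<comment> \<open>\<open>S\<close> answers only consistent trajectories of \<open>E\<close>. The
      interconnected state is consistent, and a concatenation determines its first part once that
      part's dimension is fixed, so \<open>xe t\<close> is consistent.\<close>
    have xe_con: "xe t \<in> consistent E" if t: "t \<ge> 0" for t
    proof -
      have "xe t @\<^sub>v x t \<in> (\<lambda>(xe, x). xe @\<^sub>v x) ` (consistent E \<times> carrier_vec ?n)"
        using asm t unfolding z1[OF t, symmetric] consistent_interconnection[OF E \<Sigma>] by blast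
      then obtain ve v where v: "xe t @\<^sub>v x t = ve @\<^sub>v v" "ve \<in> consistent E"
        by auto
      then have "ve \<in> carrier_vec (state_dim E)"
        using consistent_subset_carrier by blast
      then show ?thesis
        using append_vec_eq[OF trajectoryD(1)[OF xe t], of ve "x t" v] v by simp
    qed
    \<comment> \<open>Membership in \<open>T\<close> brings its own decomposition of
      \<open>z1 0\<close>. By uniqueness it is the one coming from the trajectory, so
      \<open>S\<close> applies at \<open>xe 0\<close>.\<close>
    obtain xe0 xa0 x0 where w: "(z1 0, z2) = (xe0 @\<^sub>v x0, xa0 @\<^sub>v x0)" "(xe0, xa0) \<in> S"
      using asm by (blast elim: TE)
    then have "xe 0 = xe0" "x 0 = x0"
      using append_vec_eq[OF trajectoryD(1)[OF xe order_refl] Sc(1)[OF w(2)], of "x 0" x0] z1[of 0] by simp_all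
    with w have w': "(xe 0, xa0) \<in> S" "z2 = xa0 @\<^sub>v x 0" by auto
    obtain xa da where xa: "trajectory A xa da" "xa 0 = xa0"
      "\<forall>t\<ge>0. (xe t, xa t) \<in> S \<and> con_C E *\<^sub>v xe t = con_C A *\<^sub>v xa t"
      using S(1) w'(1) xe xe_con unfolding simulation_relation_def by blast
    \<comment> \<open>\<open>xe\<close> and \<open>xa\<close> produce the same input for
      \<open>t \<ge> 0\<close>, so the trajectory of \<open>\<Sigma>\<close> is reused unchanged,
      with the same driving variable.\<close>
    have "sys_trajectory \<Sigma> (\<lambda>t. con_C A *\<^sub>v xa t) x d"
      using x xa(3) unfolding sys_trajectory_def by simp
    then have "trajectory (A \<and>\<^sub>s \<Sigma>) (\<lambda>t. xa t @\<^sub>v x t) (\<lambda>t. da t @\<^sub>v d t)"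
      by (intro trajectory_interconnection_iff[OF A \<Sigma>, where xe = xa and de = da and x = x and d = d, THEN iffD2])
        (simp_all add: trajectoryD(1,2)[OF xa(1)] xc xa(1))
    moreover have "(z1 t, xa t @\<^sub>v x t) \<in> T" if "t \<ge> 0" for t
      using that xa(3) xc z1 TI by simp
    \<comment> \<open>The \<open>u\<close> part of the outputs agrees by \<open>S\<close>, the
      \<open>y\<close> part because \<open>x\<close> is shared.\<close>
    moreover have "con_C (E \<and>\<^sub>s \<Sigma>) *\<^sub>v z1 t = con_C (A \<and>\<^sub>s \<Sigma>) *\<^sub>v (xa t @\<^sub>v x t)" if t: "t \<ge> 0" for t
      using t xa(3) unfolding z1[OF t] con_C_interconnection[OF E \<Sigma> trajectoryD(1)[OF xe t] xc(1)[OF t]]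
        con_C_interconnection[OF A \<Sigma> trajectoryD(1)[OF xa(1) t] xc(1)[OF t]] by simp
    ultimately show "\<exists>x2 d2. trajectory (A \<and>\<^sub>s \<Sigma>) x2 d2 \<and> x2 0 = z2 \<and>
        (\<forall>t\<ge>0. (z1 t, x2 t) \<in> T \<and> con_C (E \<and>\<^sub>s \<Sigma>) *\<^sub>v z1 t = con_C (A \<and>\<^sub>s \<Sigma>) *\<^sub>v x2 t)"
      using xa(2) w'(2) by (intro exI[of _ "\<lambda>t. xa t @\<^sub>v x t"] exI[of _ "\<lambda>t. da t @\<^sub>v d t"]) auto
  qed
  with fst_T show ?thesis unfolding simulated_by_def by blast
qed

theorem theorem3:
  fixes m p :: nat
    and \<C> :: contract and \<Sigma> :: lin_sys
  assumes "is_contract m p \<C>"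
    and "is_system m p \<Sigma>"
  shows "implements m \<Sigma> \<C> \<longleftrightarrow> assumptions \<C> \<and>\<^sub>s \<Sigma> \<preceq> guarantees \<C>"
proof
  have A: "is_con_sys m (assumptions \<C>)"
    using assms(1) by (simp add: is_contract_def is_environment_def)
  show "assumptions \<C> \<and>\<^sub>s \<Sigma> \<preceq> guarantees \<C>" if "implements m \<Sigma> \<C>"
    using that simulated_by_refl[OF A] A
    by (simp add: implements_def compatible_def is_environment_def)
  show "implements m \<Sigma> \<C>" if "assumptions \<C> \<and>\<^sub>s \<Sigma> \<preceq> guarantees \<C>"
    using simulated_by_trans[OF interconnection_mono[OF _ A assms(2)] that]
    by (simp add: implements_def compatible_def is_environment_def)
qed

end
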